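(* Let $S$ be a semigroup. The following conditions are equivalent: (1) the lower non-nilpotent graph $\mathcal{L}_S$ is complete; (2) the upper non-nilpotent graph $\mathcal{N}_S$ is complete; (3) the non-commuting graph $\mathcal{M}_S$ is complete; (4) $S$ is a completely simple semigroup that is a band, or equivalently, $S\cong\mathcal{M}(\{e\},I,\Lambda;P)$ for some non-empty sets $I,\Lambda$ (a Rees matrix semigroup over the trivial group $\{e\}$ with sandwich matrix $P$ all of whose entries equal $e$).
   Context: For a semigroup $S$, $S^1$ denotes $S$ if $S$ has an identity, and otherwise $S$ with an identity $1$ adjoined. For $x,y\in S$ and $z_1,z_2,\ldots\in S^1$ define recursively $\lambda_0=x$, $\rho_0=y$, $\lambda_{n+1}=\lambda_n z_{n+1}\rho_n$, $\rho_{n+1}=\rho_n z_{n+1}\lambda_n$; write $\lambda_n(x,y,z_1,\ldots,z_n)$, $\rho_n(x,y,z_1,\ldots,z_n)$. A semigroup $S$ is nilpotent (in the sense of Malcev) if there is a positive integer $n$ with $\lambda_n(a,b,c_1,\ldots,c_n)=\rho_n(a,b,c_1,\ldots,c_n)$ for all $a,b\in S$, $c_1,\ldots,c_n\in S^1$. All three graphs have vertex set $S$. In $\mathcal{N}_S$ distinct $x,y$ are adjacent iff the subsemigroup $\langle x,y\rangle$ is not nilpotent. In $\mathcal{L}_S$ distinct $x,y$ are adjacent iff there are $n\ge 1$ and $w_1,\ldots,w_n\in\langle x,y\rangle^1$ with $x=\lambda_n(x,y,w_1,\ldots,w_n)$ and $y=\rho_n(x,y,w_1,\ldots,w_n)$.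 In $\mathcal{M}_S$ distinct $x,y$ are adjacent iff $xy\ne yx$. A graph is complete if every two distinct vertices are adjacent. A band is a semigroup all of whose elements are idempotent. $\mathcal{M}(G,I,\Lambda;P)$ is the Rees matrix semigroup over a group $G$ with $\Lambda\times I$ sandwich matrix $P$ with entries in $G$ (elements $g_{ij}$, $g\in G$, $i\in I$, $j\in\Lambda$, and $g_{ij}h_{kl}=(g\,p_{jk}\,h)_{il}$). *)

theory Defs
  imports "HOL-Algebra.Group"
begin

(* Semigroups are carried by the record type of HOL-Algebra, whose notions hom, iso and
   is_iso only refer to carrier and mult. The field one of a semigroup has no meaning and
   is never used. As usual, semigroups are non-empty. *)
locale carrier_semigroup =
  fixes S (structure)
  assumes nonempty: "carrier S \<noteq> {}"
    and closed: "\<lbrakk>x \<in> carrier S; y \<in> carrier S\<rbrakk> \<Longrightarrow> x \<otimes> y \<in> carrier S"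
    and assoc: "\<lbrakk>x \<in> carrier S; y \<in> carrier S; z \<in> carrier S\<rbrakk>
      \<Longrightarrow> (x \<otimes> y) \<otimes> z = x \<otimes> (y \<otimes> z)"

definition is_identity :: "('a, 'b) monoid_scheme \<Rightarrow> 'a \<Rightarrow> bool" where
  "is_identity S e \<longleftrightarrow>
     e \<in> carrier S \<and> (\<forall>x\<in>carrier S. e \<otimes>\<^bsub>S\<^esub> x = x \<and> x \<otimes>\<^bsub>S\<^esub> e = x)"

fun opt_mult :: "('a, 'b) monoid_scheme \<Rightarrow> 'a option \<Rightarrow> 'a option \<Rightarrow> 'a option" where
  "opt_mult S None y = y"
| "opt_mult S x None = x"
| "opt_mult S (Some x) (Some y) = Some (x \<otimes>\<^bsub>S\<^esub> y)"

(* The monoid S^1: S is embedded by Some, and None is the adjoined identity. It belongs to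
   the carrier only if S has no identity. *)
definition adjoin_one :: "('a, 'b) monoid_scheme \<Rightarrow> 'a option monoid" where
  "adjoin_one S = \<lparr>
     carrier = Some ` carrier S \<union> (if \<exists>e. is_identity S e then {} else {None}),
     mult = opt_mult S,
     one = (if \<exists>e. is_identity S e then Some (THE e. is_identity S e) else None)\<rparr>"

(* Only the values z 1, ..., z n enter into malcev_lam M x y z n and malcev_rho M x y z n. *)
fun malcev_lam :: "('a, 'b) monoid_scheme \<Rightarrow> 'a \<Rightarrow> 'a \<Rightarrow> (nat \<Rightarrow> 'a) \<Rightarrow> nat \<Rightarrow> 'a"
  and malcev_rho :: "('a, 'b) monoid_scheme \<Rightarrow> 'a \<Rightarrow> 'a \<Rightarrow> (nat \<Rightarrow> 'a) \<Rightarrow> nat \<Rightarrow> 'a" where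
  "malcev_lam M x y z 0 = x"
| "malcev_rho M x y z 0 = y"
| "malcev_lam M x y z (Suc n) =
     (malcev_lam M x y z n \<otimes>\<^bsub>M\<^esub> z (Suc n)) \<otimes>\<^bsub>M\<^esub> malcev_rho M x y z n"
| "malcev_rho M x y z (Suc n) =
     (malcev_rho M x y z n \<otimes>\<^bsub>M\<^esub> z (Suc n)) \<otimes>\<^bsub>M\<^esub> malcev_lam M x y z n"

definition malcev_nilpotent :: "('a, 'b) monoid_scheme \<Rightarrow> bool" where
  "malcev_nilpotent S \<longleftrightarrow>
     (\<exists>n\<ge>1. \<forall>a\<in>carrier S. \<forall>b\<in>carrier S. \<forall>c.
        (\<forall>i\<in>{1..n}. c i \<in> carrier (adjoin_one S)) \<longrightarrow>
        malcev_lam (adjoin_one S) (Some a) (Some b) c n =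
        malcev_rho (adjoin_one S) (Some a) (Some b) c n)"

inductive_set subsemigroup_gen :: "('a, 'b) monoid_scheme \<Rightarrow> 'a set \<Rightarrow> 'a set"
  for S and A where
  incl: "a \<in> A \<Longrightarrow> a \<in> subsemigroup_gen S A"
| mult: "\<lbrakk>a \<in> subsemigroup_gen S A; b \<in> subsemigroup_gen S A\<rbrakk>
    \<Longrightarrow> a \<otimes>\<^bsub>S\<^esub> b \<in> subsemigroup_gen S A"

definition generated2 :: "('a, 'b) monoid_scheme \<Rightarrow> 'a \<Rightarrow> 'a \<Rightarrow> ('a, 'b) monoid_scheme" where
  "generated2 S x y = S\<lparr>carrier := subsemigroup_gen S {x, y}\<rparr>"

(* The three graphs have vertex set carrier S and are given by their adjacency relations. *)

definition upper_nonnilpotent_graph :: "('a, 'b) monoid_scheme \<Rightarrow> 'a rel" where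
  "upper_nonnilpotent_graph S =
     {(x, y). x \<in> carrier S \<and> y \<in> carrier S \<and> x \<noteq> y \<and> \<not> malcev_nilpotent (generated2 S x y)}"

definition lower_nonnilpotent_graph :: "('a, 'b) monoid_scheme \<Rightarrow> 'a rel" where
  "lower_nonnilpotent_graph S =
     {(x, y). x \<in> carrier S \<and> y \<in> carrier S \<and> x \<noteq> y \<and>
       (\<exists>n\<ge>1. \<exists>w. (\<forall>i\<in>{1..n}. w i \<in> carrier (adjoin_one (generated2 S x y))) \<and>
          Some x = malcev_lam (adjoin_one (generated2 S x y)) (Some x) (Some y) w n \<and>
          Some y = malcev_rho (adjoin_one (generated2 S x y)) (Some x) (Some y) w n)}"

definition noncommuting_graph :: "('a, 'b) monoid_scheme \<Rightarrow> 'a rel" where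
  "noncommuting_graph S =
     {(x, y). x \<in> carrier S \<and> y \<in> carrier S \<and> x \<noteq> y \<and> x \<otimes>\<^bsub>S\<^esub> y \<noteq> y \<otimes>\<^bsub>S\<^esub> x}"

definition complete_graph :: "'a set \<Rightarrow> 'a rel \<Rightarrow> bool" where
  "complete_graph V E \<longleftrightarrow> (\<forall>x\<in>V. \<forall>y\<in>V. x \<noteq> y \<longrightarrow> (x, y) \<in> E)"

definition is_band :: "('a, 'b) monoid_scheme \<Rightarrow> bool" where
  "is_band S \<longleftrightarrow> (\<forall>x\<in>carrier S. x \<otimes>\<^bsub>S\<^esub> x = x)"

definition semigroup_ideal :: "('a, 'b) monoid_scheme \<Rightarrow> 'a set \<Rightarrow> bool" where
  "semigroup_ideal S J \<longleftrightarrow> J \<noteq> {} \<and> J \<subseteq> carrier S \<and>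
     (\<forall>s\<in>carrier S. \<forall>a\<in>J. s \<otimes>\<^bsub>S\<^esub> a \<in> J \<and> a \<otimes>\<^bsub>S\<^esub> s \<in> J)"

definition simple_semigroup :: "('a, 'b) monoid_scheme \<Rightarrow> bool" where
  "simple_semigroup S \<longleftrightarrow> (\<forall>J. semigroup_ideal S J \<longrightarrow> J = carrier S)"

(* Minimal in the natural order of all idempotents; there is no exception for a zero,
   since a simple semigroup has a zero only if it is trivial. *)
definition primitive_idempotent :: "('a, 'b) monoid_scheme \<Rightarrow> 'a \<Rightarrow> bool" where
  "primitive_idempotent S e \<longleftrightarrow> e \<in> carrier S \<and> e \<otimes>\<^bsub>S\<^esub> e = e \<and>
     (\<forall>f\<in>carrier S. f \<otimes>\<^bsub>S\<^esub> f = f \<and> e \<otimes>\<^bsub>S\<^esub> f = f \<and> f \<otimes>\<^bsub>S\<^esub> e = f \<longrightarrow> f = e)"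

definition completely_simple :: "('a, 'b) monoid_scheme \<Rightarrow> bool" where
  "completely_simple S \<longleftrightarrow> simple_semigroup S \<and> (\<exists>e. primitive_idempotent S e)"

(* The triple (g, i, j) is the element of the Rees matrix semigroup with group entry g in
   row i and column j. The field one is a dummy. *)
definition rees_matrix_semigroup ::
  "('g, 'c) monoid_scheme \<Rightarrow> 'i set \<Rightarrow> 'j set \<Rightarrow> ('j \<Rightarrow> 'i \<Rightarrow> 'g) \<Rightarrow> ('g \<times> 'i \<times> 'j) monoid" where
  "rees_matrix_semigroup G I J P = \<lparr>
     carrier = carrier G \<times> I \<times> J,
     mult = (\<lambda>(g, i, j) (h, k, l). (g \<otimes>\<^bsub>G\<^esub> P j k \<otimes>\<^bsub>G\<^esub> h, i, l)),
     one = undefined\<rparr>"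

end

theory Submission
  imports Defs
begin

text \<open>
  All conditions are equivalent to the identity \<open>x y x = x\<close>. If distinct elements never commute,
  then this identity holds because \<open>x\<close> commutes with \<open>x x\<close>, hence is idempotent, and then commutes
  with \<open>x y x\<close>. Conversely the identity gives \<open>\<lambda>\<^sub>2(x, y, x, x) = x\<close> and \<open>\<rho>\<^sub>2(x, y, x, x) = y\<close>,
  and if \<open>(x, y)\<close> recurs in its own Malcev sequence, a periodic choice of the parameters keeps
  the two components distinct, so that \<open>\<langle>x, y\<rangle>\<close> is not nilpotent; a commutative semigroup on the
  other hand is nilpotent. If a band has a primitive idempotent \<open>e\<close>, then \<open>e x e\<close> is an idempotent
  below \<open>e\<close>, hence equal to \<open>e\<close>, and simplicity allows one to write every element as \<open>a e b\<close>.
\<close>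

definition rectangular :: "('a, 'b) monoid_scheme \<Rightarrow> bool" where
  "rectangular S \<longleftrightarrow> (\<forall>x\<in>carrier S. \<forall>y\<in>carrier S. x \<otimes>\<^bsub>S\<^esub> y \<otimes>\<^bsub>S\<^esub> x = x)"

section \<open>Malcev sequences and nilpotency\<close>

lemma malcev_shift:
  "malcev_lam M x y z (m + n) =
     malcev_lam M (malcev_lam M x y z m) (malcev_rho M x y z m) (\<lambda>i. z (m + i)) n"
  "malcev_rho M x y z (m + n) =
     malcev_rho M (malcev_lam M x y z m) (malcev_rho M x y z m) (\<lambda>i. z (m + i)) n"
  by (induction n) auto

lemma malcev_cong:
  assumes "\<And>i. i \<in> {1..n} \<Longrightarrow> z i = z' i"
  shows "malcev_lam M x y z n = malcev_lam M x y z' n \<and> malcev_rho M x y z n = malcev_rho M x y z' n"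
  using assms by (induction n) auto

text \<open>Once the two components agree, both recursion equations form the same product.\<close>

lemma malcev_eq_mono:
  assumes "malcev_lam M x y z m = malcev_rho M x y z m" "m \<le> n"
  shows "malcev_lam M x y z n = malcev_rho M x y z n"
  using assms(2,1) by (induction rule: dec_induct) auto

text \<open>After n steps the sequence is back at its starting pair and meets the same parameters
  again.\<close>

lemma malcev_periodic:
  assumes "malcev_lam M x y z n = x" "malcev_rho M x y z n = y"
    and "\<And>i. i \<ge> 1 \<Longrightarrow> z (n + i) = z i"
  shows "malcev_lam M x y z (k * n) = x \<and> malcev_rho M x y z (k * n) = y"
proof (induction k)
  case (Suc k)
  show ?case
    using malcev_cong[of "k * n" "\<lambda>i. z (n + i)" z M x y] assms Suc
    by (simp add: malcev_shift)
qed simp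

text \<open>Nilpotency and recurrence come with unrelated lengths m and n. They are compared at
  length \<open>m * n\<close>, where the components agree by nilpotency and are x and y by
  periodicity.\<close>

lemma malcev_nilpotent_recurrence:
  assumes nil: "malcev_nilpotent T" and xy: "x \<in> carrier T" "y \<in> carrier T"
    and n: "n \<ge> 1" and w: "\<And>i. i \<in> {1..n} \<Longrightarrow> w i \<in> carrier (adjoin_one T)"
    and rec: "Some x = malcev_lam (adjoin_one T) (Some x) (Some y) w n"
      "Some y = malcev_rho (adjoin_one T) (Some x) (Some y) w n"
  shows "x = y"
proof -
  \<comment> \<open>The n-periodic extension of \<open>w 1, ..., w n\<close>. The shift by one is
    there because parameters are counted from 1; \<open>u 0\<close> is \<open>w 1\<close> and hence
    harmless.\<close>
  define u where "u i = w (Suc ((i - 1) mod n))" for i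
  have u_w: "u i = w i" if "i \<in> {1..n}" for i
    using that by (cases i) (auto simp: u_def)
  have u_per: "u (n + i) = u i" if "i \<ge> 1" for i
    using that by (cases i) (auto simp: u_def)
  have u_carrier: "u i \<in> carrier (adjoin_one T)" for i
    unfolding u_def using n by (intro w) (simp add: Suc_leI)
  from nil obtain m where "malcev_lam (adjoin_one T) (Some x) (Some y) u m =
      malcev_rho (adjoin_one T) (Some x) (Some y) u m"
    unfolding malcev_nilpotent_def using xy u_carrier by blast
  then have "malcev_lam (adjoin_one T) (Some x) (Some y) u (m * n) =
      malcev_rho (adjoin_one T) (Some x) (Some y) u (m * n)"
    by (rule malcev_eq_mono) (use n in simp)
  moreover have "malcev_lam (adjoin_one T) (Some x) (Some y) u (m * n) = Some x \<and>
      malcev_rho (adjoin_one T) (Some x) (Some y) u (m * n) = Some y"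
    using malcev_cong[of n u w "adjoin_one T" "Some x" "Some y"] u_w rec[symmetric] u_per
    by (intro malcev_periodic) auto
  ultimately show ?thesis by simp
qed

text \<open>Length 1 suffices: \<open>a c b = b c a\<close> for every c in the semigroup, and also
  for an adjoined identity.\<close>

lemma commutative_imp_malcev_nilpotent:
  assumes "carrier_semigroup T"
    and comm: "\<And>a b. a \<in> carrier T \<Longrightarrow> b \<in> carrier T \<Longrightarrow> a \<otimes>\<^bsub>T\<^esub> b = b \<otimes>\<^bsub>T\<^esub> a"
  shows "malcev_nilpotent T"
proof -
  interpret carrier_semigroup T by fact
  have "opt_mult T (opt_mult T (Some a) c) (Some b) = opt_mult T (opt_mult T (Some b) c) (Some a)"
    if "a \<in> carrier T" "b \<in> carrier T" "c \<in> carrier (adjoin_one T)" for a b c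
  proof (cases c)
    case (Some d)
    then have d: "d \<in> carrier T"
      using that by (auto simp: adjoin_one_def split: if_splits)
    have "a \<otimes>\<^bsub>T\<^esub> d \<otimes>\<^bsub>T\<^esub> b = b \<otimes>\<^bsub>T\<^esub> (d \<otimes>\<^bsub>T\<^esub> a)"
      using that d by (metis comm closed)
    with that d Some show ?thesis by (simp add: assoc)
  qed (use that comm in simp)
  then show ?thesis
    unfolding malcev_nilpotent_def by (intro exI[of _ 1]) (auto simp: adjoin_one_def)
qed

section \<open>Subsemigroups generated by two elements\<close>

lemma mult_generated2 [simp]: "mult (generated2 S x y) = mult S"
  by (simp add: generated2_def)

lemma carrier_generated2: "carrier (generated2 S x y) = subsemigroup_gen S {x, y}"
  by (simp add: generated2_def)

lemma generators_in_generated2: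
  "x \<in> carrier (generated2 S x y)" "y \<in> carrier (generated2 S x y)"
  by (auto simp: carrier_generated2 intro: subsemigroup_gen.incl)

context carrier_semigroup
begin

lemma subsemigroup_gen_closed:
  assumes "a \<in> subsemigroup_gen S A" "A \<subseteq> carrier S"
  shows "a \<in> carrier S"
  using assms by induction (auto intro: closed)

lemma semigroup_generated2:
  assumes "x \<in> carrier S" "y \<in> carrier S"
  shows "carrier_semigroup (generated2 S x y)"
proof
  show "carrier (generated2 S x y) \<noteq> {}"
    using generators_in_generated2 by fastforce
qed (use assms in \<open>auto simp: carrier_generated2 intro: subsemigroup_gen.mult
      intro!: assoc elim!: subsemigroup_gen_closed\<close>)

text \<open>The centralizer of b is closed under products.\<close>

lemma subsemigroup_gen_centralizes:
  assumes "a \<in> subsemigroup_gen S A" "A \<subseteq> carrier S" "b \<in> carrier S"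
    and "\<And>g. g \<in> A \<Longrightarrow> g \<otimes> b = b \<otimes> g"
  shows "a \<otimes> b = b \<otimes> a"
  using assms(1)
proof induction
  case (mult c d)
  then have cd: "c \<in> carrier S" "d \<in> carrier S"
    using assms(2) subsemigroup_gen_closed by auto
  have "c \<otimes> d \<otimes> b = c \<otimes> (b \<otimes> d)"
    using cd assms(3) mult.IH by (simp add: assoc)
  also have "\<dots> = b \<otimes> (c \<otimes> d)"
    using cd assms(3) mult.IH by (simp flip: assoc)
  finally show ?case .
qed (rule assms(4))

lemma malcev_nilpotent_generated2_commuting:
  assumes xy: "x \<in> carrier S" "y \<in> carrier S" and comm: "x \<otimes> y = y \<otimes> x"
  shows "malcev_nilpotent (generated2 S x y)"
proof (rule commutative_imp_malcev_nilpotent[OF semigroup_generated2[OF xy]])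
  fix a b
  assume "a \<in> carrier (generated2 S x y)" "b \<in> carrier (generated2 S x y)"
  then have ab: "a \<in> subsemigroup_gen S {x, y}" "b \<in> subsemigroup_gen S {x, y}"
    by (auto simp: carrier_generated2)
  have sub: "{x, y} \<subseteq> carrier S"
    using xy by simp
  \<comment> \<open>The centralizer argument is applied twice: first b commutes with both
    generators, then a commutes with b.\<close>
  have "b \<otimes> g = g \<otimes> b" if "g \<in> {x, y}" for g
    by (rule subsemigroup_gen_centralizes[OF ab(2) sub]) (use that xy comm in auto)
  then have "a \<otimes> b = b \<otimes> a"
    by (intro subsemigroup_gen_centralizes[OF ab(1) sub] subsemigroup_gen_closed[OF ab(2) sub]) simp
  then show "a \<otimes>\<^bsub>generated2 S x y\<^esub> b = b \<otimes>\<^bsub>generated2 S x y\<^esub> a"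
    by simp
qed

section \<open>Comparison of the three graphs\<close>

lemma lower_subset_upper: "lower_nonnilpotent_graph S \<subseteq> upper_nonnilpotent_graph S"
proof clarify
  fix x y
  assume "(x, y) \<in> lower_nonnilpotent_graph S"
  then obtain n w where "x \<in> carrier S" "y \<in> carrier S" "x \<noteq> y" "n \<ge> 1"
    "\<And>i. i \<in> {1..n} \<Longrightarrow> w i \<in> carrier (adjoin_one (generated2 S x y))"
    "Some x = malcev_lam (adjoin_one (generated2 S x y)) (Some x) (Some y) w n"
    "Some y = malcev_rho (adjoin_one (generated2 S x y)) (Some x) (Some y) w n"
    unfolding lower_nonnilpotent_graph_def by blast
  then show "(x, y) \<in> upper_nonnilpotent_graph S"
    using malcev_nilpotent_recurrence[OF _ generators_in_generated2, of S x y n w]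
    unfolding upper_nonnilpotent_graph_def by blast
qed

lemma upper_subset_noncommuting: "upper_nonnilpotent_graph S \<subseteq> noncommuting_graph S"
  using malcev_nilpotent_generated2_commuting
  by (auto simp: upper_nonnilpotent_graph_def noncommuting_graph_def)

lemma noncommuting_complete_imp_rectangular:
  assumes "complete_graph (carrier S) (noncommuting_graph S)"
  shows "rectangular S"
proof -
  have eq: "a = b" if "a \<in> carrier S" "b \<in> carrier S" "a \<otimes> b = b \<otimes> a" for a b
    using assms that by (auto simp: complete_graph_def noncommuting_graph_def)
  have idem: "x \<otimes> x = x" if "x \<in> carrier S" for x
    using that by (auto intro!: eq[of "x \<otimes> x" x] simp: assoc closed)
  have "x \<otimes> y \<otimes> x = x" if "x \<in> carrier S" "y \<in> carrier S" for x y
  proof (rule eq)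
    have "x \<otimes> y \<otimes> x \<otimes> x = x \<otimes> y \<otimes> x"
      using that by (simp add: assoc closed idem)
    also have "\<dots> = x \<otimes> (x \<otimes> y \<otimes> x)"
      using that by (simp add: closed idem flip: assoc)
    finally show "x \<otimes> y \<otimes> x \<otimes> x = x \<otimes> (x \<otimes> y \<otimes> x)" .
  qed (use that in \<open>auto intro: closed\<close>)
  then show ?thesis by (simp add: rectangular_def)
qed

section \<open>Calculation in rectangular bands\<close>

lemma rectangular_idem:
  assumes "rectangular S" "x \<in> carrier S"
  shows "x \<otimes> x = x"
  \<comment> \<open>The product of four factors x is \<open>(x x x) x = x x\<close> and also
    \<open>x (x x) x = x\<close>.\<close>
  using assms by (metis rectangular_def assoc closed)

text \<open>Expand x to \<open>x (y z) x\<close>, then contract \<open>z x z\<close> to z. Dropping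
  middle factors in this way is what reduces later products to their outer factors.\<close>

lemma rectangular_mult3:
  assumes "rectangular S" "x \<in> carrier S" "y \<in> carrier S" "z \<in> carrier S"
  shows "x \<otimes> y \<otimes> z = x \<otimes> z"
proof -
  have "x \<otimes> z = x \<otimes> (y \<otimes> z) \<otimes> x \<otimes> z"
    using assms by (simp add: rectangular_def closed)
  also have "\<dots> = x \<otimes> y \<otimes> (z \<otimes> x \<otimes> z)"
    using assms(2-) by (simp add: assoc closed)
  also have "\<dots> = x \<otimes> y \<otimes> z"
    using assms by (simp add: rectangular_def)
  finally show ?thesis ..
qed

lemma rectangular_imp_lower_complete:
  assumes "rectangular S"
  shows "complete_graph (carrier S) (lower_nonnilpotent_graph S)"
proof -
  note R = rectangular_mult3[OF assms] rectangular_idem[OF assms]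
  have "(x, y) \<in> lower_nonnilpotent_graph S" if xy: "x \<in> carrier S" "y \<in> carrier S" "x \<noteq> y" for x y
  proof -
    let ?T = "adjoin_one (generated2 S x y)"
    have "Some x \<in> carrier ?T"
      using generators_in_generated2(1)[of x S y] by (simp add: adjoin_one_def)
    \<comment> \<open>The first step leads to the pair \<open>x y\<close>, \<open>y x\<close>; the
      second leads back to x and y, the outer factors of the products.\<close>
    moreover have "malcev_lam ?T (Some x) (Some y) (\<lambda>_. Some x) 2 = Some x"
      "malcev_rho ?T (Some x) (Some y) (\<lambda>_. Some x) 2 = Some y"
      using xy by (auto simp: numeral_2_eq_2 adjoin_one_def closed R simp flip: assoc)
    ultimately show ?thesis
      unfolding lower_nonnilpotent_graph_def using xy
      by (auto intro!: exI[of _ 2] exI[of _ "\<lambda>_. Some x"])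
  qed
  then show ?thesis by (simp add: complete_graph_def)
qed

section \<open>Completely simple bands\<close>

lemma rectangular_iff_completely_simple_band:
  "rectangular S \<longleftrightarrow> completely_simple S \<and> is_band S"
proof
  assume R: "rectangular S"
  have "J = carrier S" if "semigroup_ideal S J" for J
  proof -
    obtain a where a: "a \<in> J" "a \<in> carrier S"
      using \<open>semigroup_ideal S J\<close> unfolding semigroup_ideal_def by blast
    have "x \<in> J" if "x \<in> carrier S" for x
    proof -
      have "x \<otimes> a \<otimes> x \<in> J"
        using \<open>semigroup_ideal S J\<close> a that by (simp add: semigroup_ideal_def)
      then show ?thesis using R a that by (simp add: rectangular_def)
    qed
    then show ?thesis using that by (auto simp: semigroup_ideal_def)
  qed
  moreover obtain e where e: "e \<in> carrier S"
    using nonempty by auto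
  \<comment> \<open>Every element e is a primitive idempotent: \<open>e f e\<close> is f by the
    order relation and e by the identity.\<close>
  moreover have "f = e" if "f \<in> carrier S" "e \<otimes> f = f" "f \<otimes> e = f" for f
    using e R that unfolding rectangular_def by metis
  then have "primitive_idempotent S e"
    using e rectangular_idem[OF R] by (auto simp: primitive_idempotent_def)
  ultimately show "completely_simple S \<and> is_band S"
    using rectangular_idem[OF R] unfolding completely_simple_def simple_semigroup_def is_band_def
    by blast
next
  assume CB: "completely_simple S \<and> is_band S"
  then obtain e where e: "e \<in> carrier S" "e \<otimes> e = e"
    and prim: "\<And>f. \<lbrakk>f \<in> carrier S; f \<otimes> f = f; e \<otimes> f = f; f \<otimes> e = f\<rbrakk> \<Longrightarrow> f = e"
    by (auto simp: completely_simple_def primitive_idempotent_def)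
  have idem: "x \<otimes> x = x" if "x \<in> carrier S" for x
    using CB that by (simp add: is_band_def)
  have below: "e \<otimes> x \<otimes> e = e" if x: "x \<in> carrier S" for x
  proof (rule prim)
    show "e \<otimes> (e \<otimes> x \<otimes> e) = e \<otimes> x \<otimes> e"
      using e x by (simp add: closed flip: assoc)
    show "e \<otimes> x \<otimes> e \<otimes> e = e \<otimes> x \<otimes> e"
      using e x by (simp add: assoc closed)
  qed (use e x in \<open>auto intro!: closed idem\<close>)
  \<comment> \<open>The ideal generated by e, which simplicity forces to be all of S.\<close>
  define J where "J = {a \<otimes> e \<otimes> b |a b. a \<in> carrier S \<and> b \<in> carrier S}"
  have "semigroup_ideal S J"
    unfolding semigroup_ideal_def
  proof (intro conjI ballI)
    show "J \<noteq> {}" "J \<subseteq> carrier S"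
      using e by (auto simp: J_def closed)
    fix s c
    assume s: "s \<in> carrier S" and "c \<in> J"
    then obtain a b where c: "c = a \<otimes> e \<otimes> b" "a \<in> carrier S" "b \<in> carrier S"
      by (auto simp: J_def)
    have "s \<otimes> c = (s \<otimes> a) \<otimes> e \<otimes> b" "c \<otimes> s = a \<otimes> e \<otimes> (b \<otimes> s)"
      using e c s by (simp_all add: assoc closed)
    then show "s \<otimes> c \<in> J" "c \<otimes> s \<in> J"
      using c s closed unfolding J_def by blast+
  qed
  then have J: "J = carrier S"
    using CB by (simp add: completely_simple_def simple_semigroup_def)
  have "x \<otimes> y \<otimes> x = x" if x: "x \<in> carrier S" and y: "y \<in> carrier S" for x y
  proof -
    have "x \<in> J"
      using x J by simp
    then obtain a b where ab: "x = a \<otimes> e \<otimes> b" "a \<in> carrier S" "b \<in> carrier S"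
      unfolding J_def by blast
    \<comment> \<open>Regrouping exposes a factor \<open>e z e\<close> with
      \<open>z = b y a\<close>, which collapses to e.\<close>
    have "x \<otimes> y \<otimes> x = a \<otimes> (e \<otimes> (b \<otimes> y \<otimes> a) \<otimes> e) \<otimes> b"
      using ab e y by (simp add: assoc closed)
    also have "\<dots> = x"
      using ab y by (simp add: below closed)
    finally show ?thesis .
  qed
  then show "rectangular S" by (simp add: rectangular_def)
qed

section \<open>Rees matrix semigroups over a trivial group\<close>

lemma iso_rees_imp_rectangular:
  assumes triv: "carrier G = {\<one>\<^bsub>G\<^esub>}" and "group G"
    and P: "\<And>j i. j \<in> J \<Longrightarrow> i \<in> I \<Longrightarrow> P j i = \<one>\<^bsub>G\<^esub>"
    and iso: "S \<cong> rees_matrix_semigroup G I J P"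
  shows "rectangular S"
proof -
  interpret G: group G by fact
  let ?R = "rees_matrix_semigroup G I J P"
  obtain h where h: "h \<in> hom S ?R" "inj_on h (carrier S)"
    using iso by (auto simp: is_iso_def iso_def bij_betw_def)
  \<comment> \<open>A product keeps the row of its first and the column of its last factor, and the
    group entry carries no information. The identity is then pulled back along the injective
    homomorphism h.\<close>
  have R: "a \<otimes>\<^bsub>?R\<^esub> b \<otimes>\<^bsub>?R\<^esub> a = a" if "a \<in> carrier ?R" "b \<in> carrier ?R" for a b
    using that triv P by (auto simp: rees_matrix_semigroup_def)
  have "x \<otimes> y \<otimes> x = x" if "x \<in> carrier S" "y \<in> carrier S" for x y
  proof (rule inj_onD[OF h(2)])
    show "h (x \<otimes> y \<otimes> x) = h x"
      using that h(1) R by (simp add: hom_mult hom_in_carrier closed)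
  qed (use that in \<open>auto intro: closed\<close>)
  then show ?thesis by (simp add: rectangular_def)
qed

text \<open>For a fixed e, an element x is determined by \<open>x e\<close> and \<open>e x\<close>,
  since their product is x. These representatives of the R-class and L-class of x serve as row and
  column, so both index sets are subsets of S.\<close>

lemma rectangular_imp_iso_rees:
  assumes R: "rectangular S" and triv: "carrier G = {\<one>\<^bsub>G\<^esub>}" and "group G"
  shows "\<exists>(I :: 'a set) (J :: 'a set) P. I \<noteq> {} \<and> J \<noteq> {} \<and>
    (\<forall>j\<in>J. \<forall>i\<in>I. P j i = \<one>\<^bsub>G\<^esub>) \<and> S \<cong> rees_matrix_semigroup G I J P"
proof -
  interpret G: group G by fact
  note mult3 = rectangular_mult3[OF R]
  obtain e where e: "e \<in> carrier S"
    using nonempty by auto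
  define I where "I = (\<lambda>x. x \<otimes> e) ` carrier S"
  define J where "J = (\<lambda>x. e \<otimes> x) ` carrier S"
  define P where "P = (\<lambda>(_ :: 'a) (_ :: 'a). \<one>\<^bsub>G\<^esub>)"
  define h where "h x = (\<one>\<^bsub>G\<^esub>, x \<otimes> e, e \<otimes> x)" for x
  have "h \<in> hom S (rees_matrix_semigroup G I J P)"
    using e by (auto simp: hom_def h_def rees_matrix_semigroup_def I_def J_def P_def mult3
        simp flip: assoc)
  moreover have "inj_on h (carrier S)"
  proof (rule inj_on_inverseI)
    fix x
    assume "x \<in> carrier S"
    then show "(\<lambda>(_, i, j). i \<otimes> j) (h x) = x"
      using e by (simp add: h_def closed mult3 rectangular_idem[OF R] flip: assoc)
  qed
  moreover have "h ` carrier S = carrier (rees_matrix_semigroup G I J P)"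
  proof (intro equalityI subsetI)
    fix p
    assume "p \<in> carrier (rees_matrix_semigroup G I J P)"
    then obtain x y where xy: "x \<in> carrier S" "y \<in> carrier S" "p = (\<one>\<^bsub>G\<^esub>, x \<otimes> e, e \<otimes> y)"
      by (auto simp: rees_matrix_semigroup_def I_def J_def triv)
    \<comment> \<open>The row of \<open>x y\<close> comes from x and its column from y, since
      \<open>x y e = x e\<close> and \<open>e x y = e y\<close>.\<close>
    then have "p = h (x \<otimes> y)"
      using e by (simp add: h_def mult3 flip: assoc)
    with xy show "p \<in> h ` carrier S"
      using closed by blast
  qed (auto simp: h_def rees_matrix_semigroup_def I_def J_def)
  ultimately have "S \<cong> rees_matrix_semigroup G I J P"
    by (auto simp: is_iso_def iso_def bij_betw_def)
  moreover have "I \<noteq> {}" "J \<noteq> {}" "\<forall>j\<in>J. \<forall>i\<in>I. P j i = \<one>\<^bsub>G\<^esub>"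
    using e by (auto simp: I_def J_def P_def)
  ultimately show ?thesis by blast
qed

end

theorem proposition3p4:
  fixes S :: "('a, 'b) monoid_scheme"
    and G :: "('g, 'c) monoid_scheme"
  assumes semigroup_S: "carrier_semigroup S"
    and group_G: "group G"
    and trivial_G: "carrier G = {\<one>\<^bsub>G\<^esub>}"
  shows "(complete_graph (carrier S) (lower_nonnilpotent_graph S) \<longleftrightarrow>
          complete_graph (carrier S) (upper_nonnilpotent_graph S))
    \<and> (complete_graph (carrier S) (upper_nonnilpotent_graph S) \<longleftrightarrow>
          complete_graph (carrier S) (noncommuting_graph S))
    \<and> (complete_graph (carrier S) (noncommuting_graph S) \<longleftrightarrow>
          completely_simple S \<and> is_band S)
    \<and> (completely_simple S \<and> is_band S \<longleftrightarrow>
          (\<exists>(I :: 'a set) (\<Lambda> :: 'a set) P. I \<noteq> {} \<and> \<Lambda> \<noteq> {} \<and>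
             (\<forall>j\<in>\<Lambda>. \<forall>i\<in>I. P j i = \<one>\<^bsub>G\<^esub>) \<and>
             S \<cong> rees_matrix_semigroup G I \<Lambda> P))
    \<and> (\<forall>(I :: 'i set) (\<Lambda> :: 'j set) P. I \<noteq> {} \<and> \<Lambda> \<noteq> {} \<and>
             (\<forall>j\<in>\<Lambda>. \<forall>i\<in>I. P j i = \<one>\<^bsub>G\<^esub>) \<and>
             S \<cong> rees_matrix_semigroup G I \<Lambda> P \<longrightarrow>
          completely_simple S \<and> is_band S)"
proof -
  interpret carrier_semigroup S by fact
  have mono: "complete_graph (carrier S) E'"
    if "complete_graph (carrier S) E" "E \<subseteq> E'" for E E'
    using that by (auto simp: complete_graph_def)
  \<comment> \<open>A cycle of implications: the identity makes the lower graph complete,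
    completeness passes to the upper and then to the non-commuting graph, and the last returns the
    identity.\<close>
  have lower: "rectangular S \<longleftrightarrow> complete_graph (carrier S) (lower_nonnilpotent_graph S)"
    and upper: "rectangular S \<longleftrightarrow> complete_graph (carrier S) (upper_nonnilpotent_graph S)"
    and noncomm: "rectangular S \<longleftrightarrow> complete_graph (carrier S) (noncommuting_graph S)"
    using mono[OF _ lower_subset_upper] mono[OF _ upper_subset_noncommuting]
      rectangular_imp_lower_complete noncommuting_complete_imp_rectangular by blast+
  have rees: "rectangular S \<longleftrightarrow> (\<exists>(I :: 'a set) (\<Lambda> :: 'a set) P. I \<noteq> {} \<and> \<Lambda> \<noteq> {} \<and>
      (\<forall>j\<in>\<Lambda>. \<forall>i\<in>I. P j i = \<one>\<^bsub>G\<^esub>) \<and> S \<cong> rees_matrix_semigroup G I \<Lambda> P)"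
  proof
    assume "rectangular S"
    then show "\<exists>(I :: 'a set) (\<Lambda> :: 'a set) P. I \<noteq> {} \<and> \<Lambda> \<noteq> {} \<and>
        (\<forall>j\<in>\<Lambda>. \<forall>i\<in>I. P j i = \<one>\<^bsub>G\<^esub>) \<and> S \<cong> rees_matrix_semigroup G I \<Lambda> P"
      by (rule rectangular_imp_iso_rees[OF _ trivial_G group_G])
  qed (elim exE conjE, rule iso_rees_imp_rectangular[OF trivial_G group_G], auto)
  \<comment> \<open>Existence is shown with index sets over the type of S; the converse is needed
    for index sets over arbitrary types and is therefore derived separately.\<close>
  have "\<forall>(I :: 'i set) (\<Lambda> :: 'j set) P. I \<noteq> {} \<and> \<Lambda> \<noteq> {} \<and>
      (\<forall>j\<in>\<Lambda>. \<forall>i\<in>I. P j i = \<one>\<^bsub>G\<^esub>) \<and>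
      S \<cong> rees_matrix_semigroup G I \<Lambda> P \<longrightarrow> rectangular S"
    by (intro allI impI, elim conjE, rule iso_rees_imp_rectangular[OF trivial_G group_G]) auto
  then show ?thesis
    unfolding lower[symmetric] upper[symmetric] noncomm[symmetric]
      rectangular_iff_completely_simple_band[symmetric] rees[symmetric]
    by simp
qed

end
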